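(* Let $A,M,B$ be as in the context, and suppose that $\|I-M^{-1}A\|_B<1$ and that $I-\widehat M^{-1}B$ is nonsingular. Let $n_c,\tilde n_c\in\mathbb{N}$ with $n_c\le\tilde n_c<n$. Let $P,R\in\mathbb{C}^{n\times n_c}$ and $\tilde P,\tilde R\in\mathbb{C}^{n\times\tilde n_c}$ be such that $R^HAP$ and $\tilde R^HA\tilde P$ are nonsingular and $\Pi_A(P,R)$ and $\Pi_A(\tilde P,\tilde R)$ are $B$-orthogonal. If $\mathcal R(R)\subseteq\mathcal R(\tilde R)$ or $\mathcal R(P)\subseteq\mathcal R(\tilde P)$, then $$\|E_+^{\nu_1,\nu_2}(\tilde P,\tilde R)\|_B\le\|E_+^{\nu_1,\nu_2}(P,R)\|_B$$ for any $(\nu_1,\nu_2)\in\{(1,0),(0,1),(1,1)\}$.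
   Context: $A\in\mathbb{C}^{n\times n}$ is nonsingular, $M^{-1}\in\mathbb{C}^{n\times n}$ is nonsingular, and $B\in\mathbb{C}^{n\times n}$ is Hermitian positive definite. $\|x\|_B=\sqrt{x^HBx}$ and $\|C\|_B=\sup_{x\ne0}\|Cx\|_B/\|x\|_B$. The $B$-adjoint of $C\in\mathbb{C}^{n\times n}$ is $C^+=B^{-1}C^HB$; $C$ is $B$-orthogonal if $C^+=C$. $\mathcal R(\cdot)$ denotes the range. $\mathbb{N}=\{1,2,\dots\}$. For $P,R$ with $R^HAP$ nonsingular, $\Pi_A(P,R)=P(R^HAP)^{-1}R^HA$, and for $\nu_1,\nu_2\in\mathbb{N}_0$, $$E_+^{\nu_1,\nu_2}(P,R)=(I-(M^{-1}A)^+)^{\nu_2}(I-\Pi_A(P,R))(I-M^{-1}A)^{\nu_1}.$$ The matrix $\widehat M^{-1}$ is defined by $\widehat M^{-1}=M^{-1}AB^{-1}+B^{-1}A^HM^{-H}-M^{-1}AB^{-1}A^HM^{-H}$, so that $I-\widehat M^{-1}B=(I-M^{-1}A)(I-M^{-1}A)^+$. *)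

theory Defs
  imports "HOL-Analysis.Analysis"
begin

text \<open>
  A matrix with rows indexed by \<open>'m\<close> and columns indexed by \<open>'n\<close> has type \<open>complex^'n^'m\<close>, so an
  \<open>n \<times> n\<^sub>c\<close> matrix is a \<open>complex^'c^'n\<close> with \<open>n = CARD('n)\<close> and \<open>n\<^sub>c = CARD('c)\<close>. The library
  instances of \<open>*\<close>, \<open>^\<close> and \<open>1\<close> on vectors act componentwise; matrix products, powers
  and identities are written \<open>**\<close>, \<open>mat_pow\<close> and \<open>mat 1\<close>.
\<close>

definition ctranspose :: "complex^'n^'m \<Rightarrow> complex^'m^'n" where
  "ctranspose C = (\<chi> i j. cnj (C $ j $ i))"

definition cdot :: "complex^'n \<Rightarrow> complex^'n \<Rightarrow> complex" where
  "cdot x y = (\<Sum>i\<in>UNIV. cnj (x $ i) * y $ i)"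

primrec mat_pow :: "complex^'n^'n \<Rightarrow> nat \<Rightarrow> complex^'n^'n" where
  "mat_pow C 0 = mat 1"
| "mat_pow C (Suc k) = C ** mat_pow C k"

text \<open>For Hermitian \<open>B\<close> the number \<open>x\<^sup>H B x\<close> is real, so taking real parts loses nothing.\<close>

definition hermitian_pd :: "complex^'n^'n \<Rightarrow> bool" where
  "hermitian_pd B \<longleftrightarrow> ctranspose B = B \<and> (\<forall>x. x \<noteq> 0 \<longrightarrow> 0 < Re (cdot x (B *v x)))"

definition vnorm :: "complex^'n^'n \<Rightarrow> complex^'n \<Rightarrow> real" where
  "vnorm B x = sqrt (Re (cdot x (B *v x)))"

text \<open>
  For Hermitian positive definite \<open>B\<close> the quotients are bounded (finite dimension), and there is a
  nonzero \<open>x\<close> because index types are nonempty, so the supremum in \<open>real\<close> is the true one.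
\<close>

definition mnorm :: "complex^'n^'n \<Rightarrow> complex^'n^'n \<Rightarrow> real" where
  "mnorm B C = (SUP x\<in>{x. x \<noteq> 0}. vnorm B (C *v x) / vnorm B x)"

definition adj :: "complex^'n^'n \<Rightarrow> complex^'n^'n \<Rightarrow> complex^'n^'n" where
  "adj B C = matrix_inv B ** ctranspose C ** B"

definition B_orthogonal :: "complex^'n^'n \<Rightarrow> complex^'n^'n \<Rightarrow> bool" where
  "B_orthogonal B C \<longleftrightarrow> adj B C = C"

definition mat_range :: "complex^'n^'m \<Rightarrow> (complex^'m) set" where
  "mat_range C = range (\<lambda>x. C *v x)"

definition Pi_proj ::
  "complex^'n^'n \<Rightarrow> complex^'c^'n \<Rightarrow> complex^'c^'n \<Rightarrow> complex^'n^'n" where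
  "Pi_proj A P R = P ** matrix_inv (ctranspose R ** A ** P) ** ctranspose R ** A"

definition E_plus ::
  "complex^'n^'n \<Rightarrow> complex^'n^'n \<Rightarrow> complex^'n^'n \<Rightarrow> nat \<Rightarrow> nat \<Rightarrow>
   complex^'c^'n \<Rightarrow> complex^'c^'n \<Rightarrow> complex^'n^'n" where
  "E_plus A M B \<nu>1 \<nu>2 P R =
     mat_pow (mat 1 - adj B (matrix_inv M ** A)) \<nu>2 **
     (mat 1 - Pi_proj A P R) **
     mat_pow (mat 1 - matrix_inv M ** A) \<nu>1"

text \<open>The matrix written \<open>\<open>M\<close>-hat inverse\<close> in the literature; it is not assumed to be invertible.\<close>

definition Mhat_inv ::
  "complex^'n^'n \<Rightarrow> complex^'n^'n \<Rightarrow> complex^'n^'n \<Rightarrow> complex^'n^'n" where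
  "Mhat_inv A M B =
     matrix_inv M ** A ** matrix_inv B
     + matrix_inv B ** ctranspose A ** ctranspose (matrix_inv M)
     - matrix_inv M ** A ** matrix_inv B ** ctranspose A ** ctranspose (matrix_inv M)"

end

theory Submission
  imports Defs
begin

text \<open>
  Put \<open>G = I - M\<^sup>-\<^sup>1 A\<close>, \<open>Q = I - \<Pi>\<^sub>A(P,R)\<close> and \<open>Q' = I - \<Pi>\<^sub>A(P',R')\<close>. Both \<open>\<Pi>\<close>s are
  projections, and being self-adjoint for the inner product \<open>x\<^sup>H B y\<close> they are orthogonal ones. An
  inclusion of the ranges of \<open>P\<close> gives an inclusion of the ranges of the two projections; an inclusion
  of the ranges of \<open>R\<close> gives a reversed inclusion of their kernels. For orthogonal projections
  these two conditions are the same, because adjoints turn \<open>\<Pi>' \<Pi> = \<Pi>\<close> into \<open>\<Pi> \<Pi>' = \<Pi>\<close>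
  (lemma \<open>Pi_proj_absorb\<close>). So \<open>Q'\<close> projects orthogonally onto a subspace of the range of \<open>Q\<close>,
  and \<open>Q Q' = Q' = Q' Q\<close>.

  Since \<open>Q'\<close> is a contraction, \<open>Q' G = Q' (Q G)\<close> and \<open>G\<^sup>+ Q' = (G\<^sup>+ Q) Q'\<close> yield the claim for
  \<open>(1,0)\<close> and \<open>(0,1)\<close>. The case \<open>(1,1)\<close> is reduced to \<open>(1,0)\<close> by the \<open>C\<^sup>*\<close>-identity: as
  \<open>G\<^sup>+ Q G = (Q G)\<^sup>+ (Q G)\<close>, the norm of \<open>G\<^sup>+ Q G\<close> is the square of that of \<open>Q G\<close>
  (lemma \<open>mnorm_adj_proj\<close>).
\<close>

section \<open>Conjugate transposes and adjoints\<close>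

lemma cdot_matrix_right: "cdot x (C *v y) = cdot (ctranspose C *v x) y"
proof -
  have "cdot x (C *v y) = (\<Sum>i\<in>UNIV. \<Sum>j\<in>UNIV. cnj (x $ i) * (C $ i $ j * y $ j))"
    by (simp add: cdot_def matrix_vector_mult_def sum_distrib_left)
  also have "\<dots> = (\<Sum>j\<in>UNIV. \<Sum>i\<in>UNIV. cnj (x $ i) * (C $ i $ j * y $ j))"
    by (rule sum.swap)
  also have "\<dots> = cdot (ctranspose C *v x) y"
    by (simp add: cdot_def matrix_vector_mult_def ctranspose_def sum_distrib_left mult_ac)
  finally show ?thesis .
qed

lemma ctranspose_ctranspose [simp]: "ctranspose (ctranspose C) = C"
  by (simp add: ctranspose_def vec_eq_iff)

lemma ctranspose_mult: "ctranspose (C ** D) = ctranspose D ** ctranspose C"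
  by (simp add: ctranspose_def matrix_matrix_mult_def vec_eq_iff mult.commute)

lemma ctranspose_one_minus_mult_vec: "ctranspose (mat 1 - C) *v x = x - ctranspose C *v x"
proof -
  have "ctranspose (mat 1 - C) = mat 1 - ctranspose C"
    by (simp add: ctranspose_def vec_eq_iff mat_def)
  then show ?thesis by (simp add: matrix_vector_mult_diff_rdistrib)
qed

lemma cnj_cdot: "cnj (cdot x y) = cdot y x"
  by (simp add: cdot_def mult.commute)

lemma matrix_inv_left: "invertible C \<Longrightarrow> matrix_inv C ** C = mat 1"
  and matrix_inv_right: "invertible C \<Longrightarrow> C ** matrix_inv C = mat 1"
  unfolding invertible_def matrix_inv_def by (metis (mono_tags, lifting) someI_ex)+

lemma hermitian_pd_invertible:
  fixes B :: "complex^'n^'n"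
  assumes "hermitian_pd B"
  shows "invertible B"
proof -
  have "x = 0" if "B *v x = 0" for x
  proof (rule ccontr)
    assume "x \<noteq> 0"
    with assms have "0 < Re (cdot x (B *v x))" by (simp add: hermitian_pd_def)
    with that show False by (simp add: cdot_def)
  qed
  then show ?thesis by (simp add: invertible_left_inverse matrix_left_invertible_ker)
qed

lemma adj_mult:
  assumes "hermitian_pd B"
  shows "adj B (C ** D) = adj B D ** adj B C"
proof -
  have "adj B D ** adj B C
      = matrix_inv B ** ctranspose D ** (B ** matrix_inv B) ** ctranspose C ** B"
    by (simp add: adj_def matrix_mul_assoc)
  then show ?thesis
    using matrix_inv_right[OF hermitian_pd_invertible[OF assms]]
    by (simp add: adj_def ctranspose_mult matrix_mul_assoc)
qed

lemma adj_one_minus: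
  assumes "hermitian_pd B"
  shows "adj B (mat 1 - C) = mat 1 - adj B C"
proof -
  have "matrix_inv B *v (B *v x) = x" for x
    using matrix_inv_left[OF hermitian_pd_invertible[OF assms]]
    by (simp add: matrix_vector_mul_assoc)
  then show ?thesis
    by (simp add: matrix_eq adj_def matrix_vector_mul_assoc[symmetric]
        ctranspose_one_minus_mult_vec matrix_vector_mult_diff_distrib
        matrix_vector_mult_diff_rdistrib)
qed

lemma B_orthogonal_one_minus:
  "hermitian_pd B \<Longrightarrow> B_orthogonal B C \<Longrightarrow> B_orthogonal B (mat 1 - C)"
  by (simp add: B_orthogonal_def adj_one_minus)

section \<open>The inner product of a Hermitian positive definite matrix\<close>

text \<open>
  The real part makes this a real inner product with norm \<open>vnorm B\<close>, for which \<open>adj B C\<close> is still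
  the adjoint of \<open>C\<close>; complex scalars are never needed.
\<close>

definition binner :: "complex^'n^'n \<Rightarrow> complex^'n \<Rightarrow> complex^'n \<Rightarrow> real" where
  "binner B x y = Re (cdot x (B *v y))"

lemma binner_add_right: "binner B x (y + z) = binner B x y + binner B x z"
  by (simp add: binner_def cdot_def matrix_vector_right_distrib algebra_simps sum.distrib)

lemma binner_scale_right: "binner B x (t *\<^sub>R y) = t * binner B x y"
proof -
  have "B *v (t *\<^sub>R y) = t *\<^sub>R (B *v y)"
    by (simp add: matrix_vector_mult_def vec_eq_iff scaleR_sum_right)
  then show ?thesis by (simp add: binner_def cdot_def scaleR_sum_right[symmetric])
qed

lemma binner_commute:
  assumes "hermitian_pd B"
  shows "binner B x y = binner B y x"
proof -
  have "cdot x (B *v y) = cdot (B *v x) y"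
    using assms by (simp add: cdot_matrix_right hermitian_pd_def)
  also have "\<dots> = cnj (cdot y (B *v x))" by (simp add: cnj_cdot)
  finally show ?thesis by (simp add: binner_def)
qed

lemma binner_pos: "hermitian_pd B \<Longrightarrow> x \<noteq> 0 \<Longrightarrow> 0 < binner B x x"
  by (simp add: binner_def hermitian_pd_def)

lemma binner_self:
  assumes "hermitian_pd B"
  shows "binner B x x = (vnorm B x)\<^sup>2"
proof -
  have "0 \<le> binner B x x"
    using binner_pos[OF assms, of x] by (cases "x = 0") (auto simp: binner_def cdot_def)
  then show ?thesis by (simp add: vnorm_def binner_def)
qed

lemma vnorm_nonneg: "hermitian_pd B \<Longrightarrow> 0 \<le> vnorm B x"
  using binner_pos[of B x] by (cases "x = 0") (auto simp: vnorm_def binner_def cdot_def)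

lemma vnorm_pos: "hermitian_pd B \<Longrightarrow> x \<noteq> 0 \<Longrightarrow> 0 < vnorm B x"
  using binner_pos[of B x] by (simp add: vnorm_def binner_def)

lemma vnorm_zero [simp]: "vnorm B 0 = 0"
  by (simp add: vnorm_def cdot_def)

lemma binner_Cauchy_Schwarz:
  assumes "hermitian_pd B"
  shows "binner B x y \<le> vnorm B x * vnorm B y"
proof (cases "x = 0 \<or> y = 0")
  case True
  then show ?thesis by (auto simp: binner_def cdot_def)
next
  case False
  define a b where "a = vnorm B x" and "b = vnorm B y"
  have pos: "0 < a" "0 < b" using False vnorm_pos[OF assms] by (auto simp: a_def b_def)
  \<comment> \<open>\<open>b x - a y\<close> is a difference of two vectors of equal norm \<open>a b\<close>, so the expansion of its
      square is \<open>2 a b (a b - \<langle>x, y\<rangle>)\<close>.\<close>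
  define z where "z = b *\<^sub>R x + (- a) *\<^sub>R y"
  have left: "binner B z w = b * binner B x w - a * binner B y w" for w
    unfolding binner_commute[OF assms, of _ w] z_def
    by (simp only: binner_add_right binner_scale_right)
  have "binner B z z = 2 * (a * b) * (a * b - binner B x y)"
    unfolding left
    unfolding z_def binner_add_right binner_scale_right
    unfolding binner_self[OF assms] binner_commute[OF assms, of y x] a_def[symmetric] b_def[symmetric]
    by (simp add: algebra_simps power2_eq_square)
  moreover have "0 \<le> binner B z z" by (simp add: binner_self[OF assms])
  ultimately have "0 \<le> a * b - binner B x y"
    using mult_pos_pos[OF pos] by (auto simp: zero_le_mult_iff)
  then show ?thesis by (simp add: a_def b_def)
qed

lemma binner_adj:
  assumes "hermitian_pd B"
  shows "binner B x (adj B C *v y) = binner B (C *v x) y"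
proof -
  have "B *v (adj B C *v y) = (B ** matrix_inv B) *v (ctranspose C *v (B *v y))"
    by (simp add: adj_def matrix_vector_mul_assoc matrix_mul_assoc)
  then have "B *v (adj B C *v y) = ctranspose C *v (B *v y)"
    using matrix_inv_right[OF hermitian_pd_invertible[OF assms]] by simp
  then show ?thesis by (simp add: binner_def cdot_matrix_right[of x])
qed

lemma binner_B_orthogonal:
  "hermitian_pd B \<Longrightarrow> B_orthogonal B Q \<Longrightarrow> binner B x (Q *v y) = binner B (Q *v x) y"
  using binner_adj[of B x Q y] by (simp add: B_orthogonal_def)

section \<open>The operator norm\<close>

text \<open>
  A real supremum is meaningful only over a bounded set. The quotient does not change under scaling
  of \<open>x\<close>, so it is enough to bound it on the compact Euclidean unit sphere, where it is continuous.
\<close>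

lemma bdd_above_vnorm_quotient:
  fixes B C :: "complex^'n^'n"
  assumes B: "hermitian_pd B"
  shows "bdd_above ((\<lambda>x. vnorm B (C *v x) / vnorm B x) ` {x. x \<noteq> 0})"
proof -
  define f where "f = (\<lambda>x. vnorm B (C *v x) / vnorm B x)"
  have mult_cont: "continuous_on S (\<lambda>x. D *v h x)" if "continuous_on S h"
    for D :: "complex^'n^'n" and S :: "(complex^'n) set" and h :: "complex^'n \<Rightarrow> complex^'n"
    unfolding matrix_vector_mult_def using that by (intro continuous_intros) auto
  have vnorm_cont: "continuous_on S (\<lambda>x. vnorm B (h x))" if "continuous_on S h"
    for S :: "(complex^'n) set" and h :: "complex^'n \<Rightarrow> complex^'n"
    unfolding vnorm_def cdot_def using that by (intro continuous_intros mult_cont)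
  have "vnorm B x \<noteq> 0" if "x \<in> sphere 0 1" for x
    using vnorm_pos[OF B, of x] that by force
  then have "continuous_on (sphere 0 1) f"
    unfolding f_def by (intro continuous_on_divide vnorm_cont mult_cont continuous_on_id) auto
  then have "bounded (f ` sphere 0 1)"
    by (intro compact_imp_bounded compact_continuous_image compact_sphere)
  then obtain K where "\<forall>y\<in>f ` sphere 0 1. \<bar>y\<bar> \<le> K"
    unfolding bounded_real by blast
  then have K: "f x \<le> K" if "x \<in> sphere 0 1" for x
    using imageI[OF that, of f] abs_le_D1 by blast
  have scale: "vnorm B (t *\<^sub>R x) = \<bar>t\<bar> * vnorm B x" for t x
  proof -
    have "binner B (t *\<^sub>R x) (t *\<^sub>R x) = t * (t * binner B x x)"
      by (simp add: binner_scale_right binner_commute[OF B, of "t *\<^sub>R x" x])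
    then show ?thesis
      by (simp add: vnorm_def binner_def mult.assoc[symmetric] real_sqrt_mult)
  qed
  have "f x \<le> K" if "x \<noteq> 0" for x
  proof -
    have "C *v (inverse (norm x) *\<^sub>R x) = inverse (norm x) *\<^sub>R (C *v x)"
      by (simp add: matrix_vector_mult_def vec_eq_iff scaleR_sum_right)
    then have "f (inverse (norm x) *\<^sub>R x) = f x" using that by (simp add: f_def scale)
    then show ?thesis using K[of "inverse (norm x) *\<^sub>R x"] that by simp
  qed
  then show ?thesis unfolding f_def bdd_above_def by auto
qed

lemma vnorm_mult_le_mnorm:
  assumes B: "hermitian_pd B"
  shows "vnorm B (C *v x) \<le> mnorm B C * vnorm B x"
proof (cases "x = 0")
  case False
  then have "vnorm B (C *v x) / vnorm B x \<le> mnorm B C"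
    unfolding mnorm_def by (intro cSUP_upper bdd_above_vnorm_quotient[OF B]) auto
  then show ?thesis using vnorm_pos[OF B False] by (simp add: divide_le_eq)
qed simp

lemma mnorm_le:
  fixes B C :: "complex^'n^'n"
  assumes B: "hermitian_pd B" and le: "\<And>x. vnorm B (C *v x) \<le> K * vnorm B x"
  shows "mnorm B C \<le> K"
  unfolding mnorm_def
proof (rule cSUP_least)
  show "{x::complex^'n. x \<noteq> 0} \<noteq> {}"
    by (auto intro: exI[of _ "axis undefined 1"] simp: axis_eq_0_iff)
  show "vnorm B (C *v x) / vnorm B x \<le> K" if "x \<in> {x. x \<noteq> 0}" for x
    using that le[of x] vnorm_pos[OF B, of x] by (simp add: divide_le_eq)
qed

lemma mnorm_nonneg:
  fixes B C :: "complex^'n^'n"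
  assumes B: "hermitian_pd B"
  shows "0 \<le> mnorm B C"
proof -
  define e :: "complex^'n" where "e = axis undefined 1"
  have "e \<noteq> 0" by (simp add: e_def axis_eq_0_iff)
  moreover have "0 \<le> mnorm B C * vnorm B e"
    using vnorm_nonneg[OF B, of "C *v e"] vnorm_mult_le_mnorm[OF B, of C e] by linarith
  ultimately show ?thesis using vnorm_pos[OF B, of e] by (simp add: zero_le_mult_iff)
qed

section \<open>Orthogonal projections\<close>

lemma orthogonal_projection_contraction:
  assumes B: "hermitian_pd B" and "B_orthogonal B Q" and "Q ** Q = Q"
  shows "vnorm B (Q *v x) \<le> vnorm B x"
proof -
  have "(vnorm B (Q *v x))\<^sup>2 = binner B x (Q *v x)"
    using binner_B_orthogonal[OF assms(1,2), of x "Q *v x"] assms(3)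
    by (simp add: binner_self[OF B] matrix_vector_mul_assoc)
  also have "\<dots> \<le> vnorm B x * vnorm B (Q *v x)" by (rule binner_Cauchy_Schwarz[OF B])
  finally show ?thesis
    using vnorm_nonneg[OF B, of "Q *v x"] vnorm_nonneg[OF B, of x]
    by (cases "vnorm B (Q *v x) = 0") (auto simp: power2_eq_square)
qed

text \<open>The \<open>C\<^sup>*\<close>-identity for \<open>Q G\<close>, whose adjoint is \<open>G\<^sup>+ Q\<close>.\<close>

lemma mnorm_adj_proj:
  assumes B: "hermitian_pd B" and Q: "B_orthogonal B Q" "Q ** Q = Q"
  shows "mnorm B (adj B G ** Q ** G) = (mnorm B (Q ** G))\<^sup>2"
proof (rule antisym)
  define K N where "K = mnorm B (Q ** G)" and "N = mnorm B (adj B G ** Q ** G)"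
  have K0: "0 \<le> K" and N0: "0 \<le> N" by (simp_all add: K_def N_def mnorm_nonneg[OF B])
  have inner: "binner B y ((adj B G ** Q ** G) *v x) = binner B ((Q ** G) *v y) ((Q ** G) *v x)"
    for x y
  proof -
    have "binner B y ((adj B G ** Q ** G) *v x) = binner B (G *v y) (Q *v (G *v x))"
      by (simp add: matrix_vector_mul_assoc[symmetric] binner_adj[OF B])
    also have "\<dots> = binner B (G *v y) (Q *v (Q *v (G *v x)))"
      by (simp add: matrix_vector_mul_assoc matrix_mul_assoc Q(2))
    also have "\<dots> = binner B (Q *v (G *v y)) (Q *v (G *v x))"
      by (rule binner_B_orthogonal[OF B Q(1)])
    finally show ?thesis by (simp add: matrix_vector_mul_assoc)
  qed
  have "vnorm B ((adj B G ** Q ** G) *v x) \<le> K\<^sup>2 * vnorm B x" for x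
  proof -
    define v where "v = (adj B G ** Q ** G) *v x"
    have "(vnorm B v)\<^sup>2 = binner B ((Q ** G) *v v) ((Q ** G) *v x)"
      unfolding inner[symmetric] v_def[symmetric] by (simp add: binner_self[OF B])
    also have "\<dots> \<le> vnorm B ((Q ** G) *v v) * vnorm B ((Q ** G) *v x)"
      by (rule binner_Cauchy_Schwarz[OF B])
    also have "\<dots> \<le> (K * vnorm B v) * (K * vnorm B x)"
      unfolding K_def
      by (intro mult_mono vnorm_mult_le_mnorm[OF B] mult_nonneg_nonneg vnorm_nonneg[OF B]
          mnorm_nonneg[OF B])
    finally have "vnorm B v * vnorm B v \<le> vnorm B v * (K\<^sup>2 * vnorm B x)"
      by (simp add: power2_eq_square mult_ac)
    then show ?thesis
      using vnorm_nonneg[OF B, of v] vnorm_nonneg[OF B, of x] unfolding v_def[symmetric]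
      by (cases "vnorm B v = 0") auto
  qed
  then show "mnorm B (adj B G ** Q ** G) \<le> (mnorm B (Q ** G))\<^sup>2"
    unfolding K_def by (rule mnorm_le[OF B])
  have "vnorm B ((Q ** G) *v x) \<le> sqrt N * vnorm B x" for x
  proof -
    have "(vnorm B ((Q ** G) *v x))\<^sup>2 = binner B x ((adj B G ** Q ** G) *v x)"
      by (simp add: inner binner_self[OF B])
    also have "\<dots> \<le> vnorm B x * vnorm B ((adj B G ** Q ** G) *v x)"
      by (rule binner_Cauchy_Schwarz[OF B])
    also have "\<dots> \<le> vnorm B x * (N * vnorm B x)"
      unfolding N_def by (intro mult_left_mono vnorm_mult_le_mnorm[OF B] vnorm_nonneg[OF B])
    also have "\<dots> = (sqrt N * vnorm B x)\<^sup>2"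
      using N0 by (simp add: power_mult_distrib power2_eq_square mult_ac)
    finally show ?thesis
      by (rule power2_le_imp_le) (simp add: N0 vnorm_nonneg[OF B])
  qed
  then have "K \<le> sqrt N" unfolding K_def by (rule mnorm_le[OF B])
  then have "K\<^sup>2 \<le> (sqrt N)\<^sup>2" using K0 by (intro power_mono)
  then show "(mnorm B (Q ** G))\<^sup>2 \<le> mnorm B (adj B G ** Q ** G)"
    using N0 by (simp add: K_def N_def)
qed

lemma mnorm_proj_left_mono:
  assumes B: "hermitian_pd B" and Q': "B_orthogonal B Q'" "Q' ** Q' = Q'" and "Q' ** Q = Q'"
  shows "mnorm B (Q' ** G) \<le> mnorm B (Q ** G)"
proof (rule mnorm_le[OF B])
  fix x
  have "vnorm B ((Q' ** G) *v x) = vnorm B (Q' *v ((Q ** G) *v x))"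
    by (simp add: matrix_vector_mul_assoc matrix_mul_assoc \<open>Q' ** Q = Q'\<close>)
  also have "\<dots> \<le> vnorm B ((Q ** G) *v x)"
    by (rule orthogonal_projection_contraction[OF B Q'])
  also have "\<dots> \<le> mnorm B (Q ** G) * vnorm B x" by (rule vnorm_mult_le_mnorm[OF B])
  finally show "vnorm B ((Q' ** G) *v x) \<le> mnorm B (Q ** G) * vnorm B x" .
qed

lemma mnorm_proj_right_mono:
  assumes B: "hermitian_pd B" and Q': "B_orthogonal B Q'" "Q' ** Q' = Q'" and "Q ** Q' = Q'"
  shows "mnorm B (G ** Q') \<le> mnorm B (G ** Q)"
proof (rule mnorm_le[OF B])
  fix x
  have "vnorm B ((G ** Q') *v x) = vnorm B ((G ** Q) *v (Q' *v x))"
    by (simp add: matrix_vector_mul_assoc matrix_mul_assoc[symmetric] \<open>Q ** Q' = Q'\<close>)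
  also have "\<dots> \<le> mnorm B (G ** Q) * vnorm B (Q' *v x)" by (rule vnorm_mult_le_mnorm[OF B])
  also have "\<dots> \<le> mnorm B (G ** Q) * vnorm B x"
    by (intro mult_left_mono orthogonal_projection_contraction[OF B Q'] mnorm_nonneg[OF B])
  finally show "vnorm B ((G ** Q') *v x) \<le> mnorm B (G ** Q) * vnorm B x" .
qed

section \<open>Coarse-grid projections\<close>

lemma mat_range_subset_factor:
  fixes C :: "complex^'c^'n" and D :: "complex^'d^'n"
  assumes "mat_range C \<subseteq> mat_range D"
  obtains S where "C = D ** S"
proof -
  have "\<exists>w. C *v axis j 1 = D *v w" for j
    using assms by (auto simp: mat_range_def)
  then obtain w where w: "\<And>j. C *v axis j 1 = D *v w j" by metis
  have "C $ i $ j = (C *v axis j 1) $ i" for i j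
    by (simp add: matrix_vector_mult_def axis_def if_distrib cong: if_cong)
  then have "C = D ** (\<chi> i j. w j $ i)"
    unfolding w by (simp add: vec_eq_iff matrix_matrix_mult_def matrix_vector_mult_def)
  then show ?thesis by (rule that)
qed

lemma Pi_proj_mult_P:
  assumes "invertible (ctranspose R ** A ** P)"
  shows "Pi_proj A P R ** P = P"
proof -
  have "Pi_proj A P R ** P
      = P ** (matrix_inv (ctranspose R ** A ** P) ** (ctranspose R ** A ** P))"
    by (simp add: Pi_proj_def matrix_mul_assoc)
  then show ?thesis by (simp add: matrix_inv_left[OF assms])
qed

lemma R_mult_Pi_proj:
  assumes "invertible (ctranspose R ** A ** P)"
  shows "ctranspose R ** A ** Pi_proj A P R = ctranspose R ** A"
proof -
  have "ctranspose R ** A ** Pi_proj A P R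
      = ((ctranspose R ** A ** P) ** matrix_inv (ctranspose R ** A ** P)) ** ctranspose R ** A"
    by (simp add: Pi_proj_def matrix_mul_assoc)
  then show ?thesis by (simp add: matrix_inv_right[OF assms])
qed

text \<open>
  If \<open>P = P' S\<close>, the second identity holds because \<open>\<Pi>'\<close> fixes \<open>P'\<close>; if \<open>R = R' S\<close>, the first
  holds because \<open>R'\<^sup>H A \<Pi>' = R'\<^sup>H A\<close>. Each identity is the adjoint of the other.
\<close>

lemma Pi_proj_absorb:
  assumes B: "hermitian_pd B"
    and inv': "invertible (ctranspose R' ** A ** P')"
    and orth: "B_orthogonal B (Pi_proj A P R)" "B_orthogonal B (Pi_proj A P' R')"
    and sub: "mat_range R \<subseteq> mat_range R' \<or> mat_range P \<subseteq> mat_range P'"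
  shows "Pi_proj A P R ** Pi_proj A P' R' = Pi_proj A P R" (is "?U ** ?V = ?U")
    and "Pi_proj A P' R' ** Pi_proj A P R = Pi_proj A P R"
proof -
  have "?U ** ?V = ?U \<or> ?V ** ?U = ?U"
    using sub
  proof
    assume "mat_range R \<subseteq> mat_range R'"
    then obtain S where S: "R = R' ** S" by (rule mat_range_subset_factor)
    define X where "X = P ** matrix_inv (ctranspose R ** A ** P) ** ctranspose S"
    have U: "?U = X ** (ctranspose R' ** A)"
      unfolding Pi_proj_def X_def by (simp add: S ctranspose_mult matrix_mul_assoc)
    have "?U ** ?V = X ** (ctranspose R' ** A ** ?V)"
      unfolding U by (simp add: matrix_mul_assoc)
    also have "\<dots> = ?U" by (simp add: R_mult_Pi_proj[OF inv'] U)
    finally show ?thesis ..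
  next
    assume "mat_range P \<subseteq> mat_range P'"
    then obtain S where S: "P = P' ** S" by (rule mat_range_subset_factor)
    define X where "X = S ** matrix_inv (ctranspose R ** A ** P) ** ctranspose R ** A"
    have U: "?U = P' ** X"
      unfolding Pi_proj_def X_def by (simp add: S matrix_mul_assoc)
    have "?V ** ?U = (?V ** P') ** X"
      unfolding U by (simp add: matrix_mul_assoc)
    also have "\<dots> = ?U" by (simp add: Pi_proj_mult_P[OF inv'] U)
    finally show ?thesis ..
  qed
  moreover have "?U ** ?V = ?U \<longleftrightarrow> ?V ** ?U = ?U"
    using adj_mult[OF B, of ?U ?V] adj_mult[OF B, of ?V ?U] orth
    by (auto simp: B_orthogonal_def)
  ultimately show "?U ** ?V = ?U" and "?V ** ?U = ?U" by auto
qed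

lemma one_minus_mult_one_minus:
  fixes U V :: "complex^'n^'n"
  shows "(mat 1 - U) ** (mat 1 - V) = mat 1 - U - V + U ** V"
  by (simp add: matrix_eq algebra_simps flip: matrix_vector_mul_assoc)

theorem theorem3p23:
  fixes A M B :: "complex^'n^'n"
    and P R :: "complex^'c^'n"
    and P' R' :: "complex^'d^'n"
  assumes "invertible A" and "invertible M" and "hermitian_pd B"
    and "mnorm B (mat 1 - matrix_inv M ** A) < 1"
    and "invertible (mat 1 - Mhat_inv A M B ** B)"
    and "CARD('c) \<le> CARD('d)" and "CARD('d) < CARD('n)"
    and "invertible (ctranspose R ** A ** P)"
    and "invertible (ctranspose R' ** A ** P')"
    and "B_orthogonal B (Pi_proj A P R)"
    and "B_orthogonal B (Pi_proj A P' R')"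
    and "mat_range R \<subseteq> mat_range R' \<or> mat_range P \<subseteq> mat_range P'"
  shows "\<forall>(\<nu>1, \<nu>2) \<in> {(1, 0), (0, 1), (1, 1)}.
           mnorm B (E_plus A M B \<nu>1 \<nu>2 P' R') \<le> mnorm B (E_plus A M B \<nu>1 \<nu>2 P R)"
proof -
  note B = \<open>hermitian_pd B\<close>
  define G Q Q' where "G = mat 1 - matrix_inv M ** A"
    and "Q = mat 1 - Pi_proj A P R" and "Q' = mat 1 - Pi_proj A P' R'"
  have idem: "Pi_proj A P R ** Pi_proj A P R = Pi_proj A P R"
    "Pi_proj A P' R' ** Pi_proj A P' R' = Pi_proj A P' R'"
    using Pi_proj_absorb(1)[OF B] assms(8-11) by blast+
  note absorb = Pi_proj_absorb[OF B assms(9-12)]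
  have Q: "B_orthogonal B Q" "Q ** Q = Q" and Q': "B_orthogonal B Q'" "Q' ** Q' = Q'"
    using B_orthogonal_one_minus[OF B] assms(10,11)
    by (simp_all add: Q_def Q'_def one_minus_mult_one_minus idem)
  have QQ': "Q ** Q' = Q'" and Q'Q: "Q' ** Q = Q'"
    by (simp_all add: Q_def Q'_def one_minus_mult_one_minus absorb)
  have case10: "mnorm B (Q' ** G) \<le> mnorm B (Q ** G)"
    by (rule mnorm_proj_left_mono[OF B Q' Q'Q])
  moreover have "mnorm B (adj B G ** Q') \<le> mnorm B (adj B G ** Q)"
    by (rule mnorm_proj_right_mono[OF B Q' QQ'])
  moreover have "mnorm B (adj B G ** Q' ** G) \<le> mnorm B (adj B G ** Q ** G)"
    unfolding mnorm_adj_proj[OF B Q] mnorm_adj_proj[OF B Q']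
    by (intro power_mono case10 mnorm_nonneg[OF B])
  ultimately show ?thesis
    unfolding G_def adj_one_minus[OF B] by (simp add: E_plus_def flip: Q_def Q'_def)
qed

end
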